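(* Let $T_4^{(2)}(x,y):=\sum_{n\ge 1}x^n\sum_{T\in\mathcal{T}^{(2)}(K_4\times P_n)}y^{\rho(T)}$. Then $$T_4^{(2)}(x,y)=\frac{2xy\left(1+7y-x(y-1)\left(7y^2+y-9\right)+x^2(y-1)^2\left(8y^2-17y+8\right)\right)}{1-2x(y^2+2y+5)+x^2(y-1)(y^3+6y^2+8y-17)-x^3(y-1)^2(y^3+6y^2-17y+8)}.$$
   Context: $K_m$ is the complete graph on $m$ vertices and $P_n$ the path graph on $n$ vertices. The product $G_1\times G_2$ of graphs $G_1=(V_1,E_1)$, $G_2=(V_2,E_2)$ is the Cartesian product: its vertex set is $V_1\times V_2$, and $(v_1,v_2),(w_1,w_2)$ are adjacent iff ($v_1=w_1$ and $\{v_2,w_2\}\in E_2$) or ($v_2=w_2$ and $\{v_1,w_1\}\in E_1$). For a finite undirected graph $G=(V,E)$, two nonempty disjoint subsets $V_1,V_2\subseteq V$ are neighbors if there is an edge of $G$ with one endpoint in $V_1$ and the other in $V_2$. A $k$-colored partition of $G$ is a partition $V=\bigcup_{i=1}^s V_i$ together with an assignment of one of $k$ colors to each $V_i$ (all vertices of $V_i$ get that color), such that each $V_i$ induces a connected subgraph of $G$ and any two neighboring sets $V_i,V_j$ have different colors. The sets $V_i$ are the blocks, and the size $\rho(T)$ of a $k$-colored partition $T$ is its number of blocks. $\mathcal{T}^{(k)}(G)$ denotes the set of all $k$-colored partitions of $G$. Generating functions are formal power series in $x$ with coefficients polynomial in $y$. *)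

theory Defs
  imports Main "HOL-Library.Disjoint_Sets" "HOL-Library.FuncSet"
    "HOL-Computational_Algebra.Computational_Algebra"
begin

record 'a ugraph =
  verts :: "'a set"
  edges :: "'a set set"

definition finite_ugraph :: "'a ugraph \<Rightarrow> bool" where
  "finite_ugraph G \<longleftrightarrow> finite (verts G) \<and> (\<forall>e\<in>edges G. e \<subseteq> verts G \<and> card e = 2)"

definition complete_graph :: "nat \<Rightarrow> nat ugraph" where
  "complete_graph m = \<lparr>verts = {..<m}, edges = {{i, j} | i j. i < m \<and> j < m \<and> i \<noteq> j}\<rparr>"

definition path_graph :: "nat \<Rightarrow> nat ugraph" where
  "path_graph n = \<lparr>verts = {..<n}, edges = {{i, Suc i} | i. Suc i < n}\<rparr>"

definition cartesian_product :: "'a ugraph \<Rightarrow> 'b ugraph \<Rightarrow> ('a \<times> 'b) ugraph" where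
  "cartesian_product G H =
     \<lparr>verts = verts G \<times> verts H,
      edges = {{(v1, v2), (w1, w2)} | v1 v2 w1 w2.
        v1 \<in> verts G \<and> w1 \<in> verts G \<and> v2 \<in> verts H \<and> w2 \<in> verts H \<and>
        ((v1 = w1 \<and> {v2, w2} \<in> edges H) \<or> (v2 = w2 \<and> {v1, w1} \<in> edges G))}\<rparr>"

definition induced_subgraph :: "'a ugraph \<Rightarrow> 'a set \<Rightarrow> 'a ugraph" where
  "induced_subgraph G S = \<lparr>verts = S, edges = {e \<in> edges G. e \<subseteq> S}\<rparr>"

definition connected_graph :: "'a ugraph \<Rightarrow> bool" where
  "connected_graph G \<longleftrightarrow> verts G \<noteq> {} \<and>
     (\<forall>u\<in>verts G. \<forall>v\<in>verts G. (u, v) \<in> {(a, b). {a, b} \<in> edges G}\<^sup>*)"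

definition neighbors :: "'a ugraph \<Rightarrow> 'a set \<Rightarrow> 'a set \<Rightarrow> bool" where
  "neighbors G A B \<longleftrightarrow> A \<noteq> {} \<and> B \<noteq> {} \<and> A \<inter> B = {} \<and> (\<exists>a\<in>A. \<exists>b\<in>B. {a, b} \<in> edges G)"

text \<open>
  A colored partition is the set of its blocks together with a map from the blocks to the
  colors \<open>1, \<dots>, k\<close>.  The color map is extensional (\<open>undefined\<close> off the
  blocks), so that different values outside the blocks are not counted separately.
\<close>

definition colored_partitions :: "nat \<Rightarrow> 'a ugraph \<Rightarrow> ('a set set \<times> ('a set \<Rightarrow> nat)) set" where
  "colored_partitions k G =
     {(P, c). partition_on (verts G) P \<and> c \<in> P \<rightarrow>\<^sub>E {1..k} \<and>
        (\<forall>A\<in>P. connected_graph (induced_subgraph G A)) \<and>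
        (\<forall>A\<in>P. \<forall>B\<in>P. neighbors G A B \<longrightarrow> c A \<noteq> c B)}"

definition partition_size :: "'a set set \<times> ('a set \<Rightarrow> nat) \<Rightarrow> nat" where
  "partition_size T = card (fst T)"

text \<open>
  Power series in \<open>x\<close> (the outer \<open>fps\<close>) whose coefficients are
  polynomials in \<open>y\<close> (the inner \<open>poly\<close>).
\<close>

definition colored_partition_gf :: "nat \<Rightarrow> nat \<Rightarrow> int poly fps" where
  "colored_partition_gf k m = Abs_fps (\<lambda>n. if n = 0 then 0 else
     (\<Sum>T\<in>colored_partitions k (cartesian_product (complete_graph m) (path_graph n)).
        monom 1 (partition_size T)))"

abbreviation gf_x :: "int poly fps" where
  "gf_x \<equiv> fps_X"

abbreviation gf_y :: "int poly fps" where
  "gf_y \<equiv> fps_const (monom 1 1)"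

text \<open>
  The library's division of power series needs a field of coefficients.  Over a commutative
  ring this is the quotient by a power series with constant coefficient 1; it is
  meaningless for other denominators.
\<close>

definition fps_quotient :: "'a::comm_ring_1 fps \<Rightarrow> 'a fps \<Rightarrow> 'a fps" where
  "fps_quotient f g = f * fps_right_inverse g 1"

lemma fps_quotient_eq_iff:
  assumes "fps_nth g 0 = (1::'a::comm_ring_1)"
  shows "h = fps_quotient f g \<longleftrightarrow> h * g = f"
proof -
  have inv: "g * fps_right_inverse g 1 = 1"
    by (rule fps_right_inverse) (simp add: assms)
  show ?thesis
  proof
    assume "h = fps_quotient f g"
    then have "h * g = f * (g * fps_right_inverse g 1)"
      by (simp add: fps_quotient_def mult_ac)
    then show "h * g = f" by (simp add: inv)
  next
    assume "h * g = f"
    then have "fps_quotient f g = h * (g * fps_right_inverse g 1)"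
      by (metis fps_quotient_def mult.assoc)
    then show "h = fps_quotient f g" by (simp add: inv)
  qed
qed

lemma finite_colored_partitions:
  assumes "finite (verts G)"
  shows "finite (colored_partitions k G)"
proof (rule finite_subset)
  show "colored_partitions k G \<subseteq>
      (SIGMA P:{P. partition_on (verts G) P}. P \<rightarrow>\<^sub>E {1..k})"
    by (auto simp: colored_partitions_def)
  show "finite (SIGMA P:{P. partition_on (verts G) P}. P \<rightarrow>\<^sub>E {1..k})"
    using assms by (auto intro!: finite_SigmaI finitely_many_partition_on finite_PiE
        intro: finite_elements)
qed

lemma finite_ugraph_complete_graph: "finite_ugraph (complete_graph m)"
  by (auto simp: finite_ugraph_def complete_graph_def)

lemma finite_ugraph_path_graph: "finite_ugraph (path_graph n)"
  by (auto simp: finite_ugraph_def path_graph_def)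

lemma edge_neq: "finite_ugraph G \<Longrightarrow> {a, b} \<in> edges G \<Longrightarrow> a \<noteq> b"
  by (auto simp: finite_ugraph_def)

lemma finite_ugraph_cartesian_product:
  assumes "finite_ugraph G" "finite_ugraph H"
  shows "finite_ugraph (cartesian_product G H)"
proof -
  have "e \<subseteq> verts G \<times> verts H \<and> card e = 2"
    if "e \<in> edges (cartesian_product G H)" for e
  proof -
    obtain v1 v2 w1 w2 where e: "e = {(v1, v2), (w1, w2)}"
      and v: "v1 \<in> verts G" "w1 \<in> verts G" "v2 \<in> verts H" "w2 \<in> verts H"
      and d: "(v1 = w1 \<and> {v2, w2} \<in> edges H) \<or> (v2 = w2 \<and> {v1, w1} \<in> edges G)"
      using \<open>e \<in> _\<close> unfolding cartesian_product_def by auto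
    have "(v1, v2) \<noteq> (w1, w2)"
      using d edge_neq[OF assms(1)] edge_neq[OF assms(2)] by auto
    then show ?thesis using e v by (simp add: card_2_iff)
  qed
  then show ?thesis
    using assms by (simp add: finite_ugraph_def cartesian_product_def)
qed

end

theory Submission
  imports Defs
begin

text \<open>
  The blocks of a colored partition are the monochromatic components of the vertex coloring it
  induces, so colored partitions correspond to arbitrary colorings.  Vertices of equal color in one
  column of \<open>K_m \<times> P_n\<close> are adjacent; hence a component is determined by its color and
  its first column, and the number of components is a sum over pairs of consecutive columns.
  For two colors a column is a subset \<open>S\<close> of the vertices of \<open>K_m\<close>, and the
  weighted number of ways to continue it by a subset of given size depends only on
  \<open>card S\<close>.  This gives a linear system for the generating functions of the
  \<open>m + 1\<close> size classes, which is symmetric under complementation; for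
  \<open>m = 4\<close> three unknowns remain.
\<close>

subsection \<open>Colored partitions and vertex colorings\<close>

definition same_color_edges :: "'a ugraph \<Rightarrow> ('a \<Rightarrow> 'c) \<Rightarrow> ('a \<times> 'a) set" where
  "same_color_edges G f = {(a, b). {a, b} \<in> edges G \<and> f a = f b}"

definition color_connected :: "'a ugraph \<Rightarrow> ('a \<Rightarrow> 'c) \<Rightarrow> ('a \<times> 'a) set" where
  "color_connected G f = Restr ((same_color_edges G f)\<^sup>*) (verts G)"

definition color_components :: "'a ugraph \<Rightarrow> ('a \<Rightarrow> 'c) \<Rightarrow> 'a set set" where
  "color_components G f = verts G // color_connected G f"

definition coloring_partition :: "'a ugraph \<Rightarrow> ('a \<Rightarrow> 'c) \<Rightarrow> 'a set set \<times> ('a set \<Rightarrow> 'c)" where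
  "coloring_partition G f =
     (color_components G f, \<lambda>A \<in> color_components G f. the_elem (f ` A))"

lemma edge_in_verts:
  assumes "finite_ugraph G" "{a, b} \<in> edges G"
  shows "a \<in> verts G" "b \<in> verts G"
  using assms by (auto simp: finite_ugraph_def)

lemma equiv_color_connected: "equiv (verts G) (color_connected G f)"
proof (rule equivI)
  have "sym ((same_color_edges G f)\<^sup>*)"
    by (rule sym_rtrancl) (auto simp: same_color_edges_def sym_def insert_commute)
  then show "sym (color_connected G f)"
    by (auto simp: color_connected_def sym_def)
  show "trans (color_connected G f)"
    by (auto simp: color_connected_def trans_def)
qed (auto simp: color_connected_def refl_on_def)

lemma color_connected_imp_same_color:
  assumes "(a, b) \<in> color_connected G f"
  shows "f a = f b"
proof -
  have "(a, b) \<in> (same_color_edges G f)\<^sup>*"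
    using assms by (simp add: color_connected_def)
  then show ?thesis
    by (induction rule: rtrancl_induct) (auto simp: same_color_edges_def)
qed

lemma same_color_edges_subset_color_connected:
  assumes "finite_ugraph G"
  shows "same_color_edges G f \<subseteq> color_connected G f"
  using edge_in_verts[OF assms] by (auto simp: same_color_edges_def color_connected_def)

lemma partition_on_color_components: "partition_on (verts G) (color_components G f)"
  unfolding color_components_def by (rule partition_on_quotient[OF equiv_color_connected])

lemma color_component_subset_verts: "A \<in> color_components G f \<Longrightarrow> A \<subseteq> verts G"
  unfolding color_components_def by (rule in_quotient_imp_subset[OF equiv_color_connected])

lemma color_component_nonempty: "A \<in> color_components G f \<Longrightarrow> A \<noteq> {}"
  unfolding color_components_def by (rule in_quotient_imp_non_empty[OF equiv_color_connected])

lemma ex_color_component: "v \<in> verts G \<Longrightarrow> \<exists>A\<in>color_components G f. v \<in> A"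
  unfolding color_components_def
  by (metis equiv_class_self equiv_color_connected quotientI)

lemma color_component_closed:
  assumes "A \<in> color_components G f" "a \<in> A" "(a, b) \<in> color_connected G f"
  shows "b \<in> A"
  using in_quotient_imp_closed[OF equiv_color_connected] assms by (metis color_components_def)

lemma color_component_connected:
  assumes "A \<in> color_components G f" "a \<in> A" "b \<in> A"
  shows "(a, b) \<in> color_connected G f"
  using in_quotient_imp_in_rel[OF equiv_color_connected, of A G f] assms
  by (simp add: color_components_def)

lemma the_elem_image_color_component:
  assumes "A \<in> color_components G f" "a \<in> A"
  shows "the_elem (f ` A) = f a"
proof (rule the_elem_image_unique)
  show "A \<noteq> {}" using assms(2) by blast
  show "f b = f a" if "b \<in> A" for b
    using color_connected_imp_same_color[OF color_component_connected[OF assms that]] by simp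
qed

lemma connected_graph_color_component:
  assumes "finite_ugraph G" and component: "A \<in> color_components G f"
  shows "connected_graph (induced_subgraph G A)"
proof -
  let ?E = "{(u, v). {u, v} \<in> edges (induced_subgraph G A)}"
  have "(a, b) \<in> ?E\<^sup>*" if "a \<in> A" and "b \<in> A" for a b
  proof -
    have "(a, b) \<in> (same_color_edges G f)\<^sup>*"
      using color_component_connected[OF component that] by (simp add: color_connected_def)
    then have "b \<in> A \<and> (a, b) \<in> ?E\<^sup>*"
    proof (induction rule: rtrancl_induct)
      case (step u v)
      then have "v \<in> A"
        using color_component_closed[OF component]
          same_color_edges_subset_color_connected[OF assms(1)] by blast
      then have "(u, v) \<in> ?E"
        using step by (auto simp: same_color_edges_def induced_subgraph_def)
      then show ?case
        using step.IH \<open>v \<in> A\<close> by (auto intro: rtrancl_into_rtrancl)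
    qed (use \<open>a \<in> A\<close> in simp)
    then show ?thesis ..
  qed
  then show ?thesis
    using color_component_nonempty[OF component]
    by (simp add: connected_graph_def induced_subgraph_def)
qed

lemma neighboring_color_components_color:
  assumes "finite_ugraph G"
    and components: "A \<in> color_components G f" "B \<in> color_components G f"
    and "neighbors G A B"
  shows "the_elem (f ` A) \<noteq> the_elem (f ` B)"
proof
  assume same: "the_elem (f ` A) = the_elem (f ` B)"
  obtain a b where edge: "a \<in> A" "b \<in> B" "{a, b} \<in> edges G" and disjnt: "A \<inter> B = {}"
    using assms(4) by (auto simp: neighbors_def)
  have "f a = f b"
    using same the_elem_image_color_component[OF components(1) edge(1)]
      the_elem_image_color_component[OF components(2) edge(2)] by simp
  then have "(a, b) \<in> color_connected G f"
    using edge(3) same_color_edges_subset_color_connected[OF assms(1)]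
    by (auto simp: same_color_edges_def)
  then show False
    using color_component_closed[OF components(1) edge(1)] edge(2) disjnt by blast
qed

lemma coloring_partition_in_colored_partitions:
  assumes "finite_ugraph G" and coloring: "f \<in> verts G \<rightarrow>\<^sub>E {1..k}"
  shows "coloring_partition G f \<in> colored_partitions k G"
proof -
  have "the_elem (f ` A) \<in> {1..k}" if component: "A \<in> color_components G f" for A
  proof -
    obtain a where "a \<in> A"
      using color_component_nonempty[OF component] by blast
    then show ?thesis
      using coloring the_elem_image_color_component[OF component]
        color_component_subset_verts[OF component]
      by (metis PiE_mem subsetD)
  qed
  moreover have "\<forall>A\<in>color_components G f. connected_graph (induced_subgraph G A)"
    using connected_graph_color_component[OF assms(1)] by blast
  moreover have "\<forall>A\<in>color_components G f. \<forall>B\<in>color_components G f.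
      neighbors G A B \<longrightarrow> the_elem (f ` A) \<noteq> the_elem (f ` B)"
    using neighboring_color_components_color[OF assms(1)] by blast
  ultimately show ?thesis
    using partition_on_color_components[of G f]
    by (simp add: coloring_partition_def colored_partitions_def)
qed

lemma same_color_path_stays_in_block:
  assumes "finite_ugraph G" and colored: "(P, c) \<in> colored_partitions k G"
    and agrees: "\<And>A v. A \<in> P \<Longrightarrow> v \<in> A \<Longrightarrow> f v = c A"
    and block: "A \<in> P" "a \<in> A" and path: "(a, b) \<in> (same_color_edges G f)\<^sup>*"
  shows "b \<in> A"
  using path
proof (induction rule: rtrancl_induct)
  case (step u v)
  have partition: "partition_on (verts G) P"
    using colored by (simp add: colored_partitions_def)
  have edge: "{u, v} \<in> edges G" and same: "f u = f v"
    using step.hyps by (auto simp: same_color_edges_def)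
  obtain B where block': "B \<in> P" "v \<in> B"
    using edge_in_verts(2)[OF assms(1) edge] partition by (auto simp: partition_on_def)
  have "c A = c B"
    using agrees[OF block(1) step.IH] agrees[OF block'] same by simp
  then have "\<not> neighbors G A B"
    using colored block(1) block'(1) by (auto simp: colored_partitions_def)
  then have "A \<inter> B \<noteq> {}"
    using step.IH block'(2) edge by (auto simp: neighbors_def)
  then have "A = B"
    using disjointD[OF partition_onD2[OF partition] block(1) block'(1)] by blast
  then show ?case using block'(2) by simp
qed (use block in simp)

lemma block_same_color_path:
  assumes colored: "(P, c) \<in> colored_partitions k G"
    and agrees: "\<And>A v. A \<in> P \<Longrightarrow> v \<in> A \<Longrightarrow> f v = c A"
    and block: "A \<in> P" "a \<in> A" "b \<in> A"
  shows "(a, b) \<in> (same_color_edges G f)\<^sup>*"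
proof -
  let ?E = "{(u, v). {u, v} \<in> edges (induced_subgraph G A)}"
  have "connected_graph (induced_subgraph G A)"
    using colored block(1) by (auto simp: colored_partitions_def)
  then have "(a, b) \<in> ?E\<^sup>*"
    using block(2,3) by (auto simp: connected_graph_def induced_subgraph_def)
  moreover have "?E \<subseteq> same_color_edges G f"
    using agrees[OF block(1)] by (auto simp: same_color_edges_def induced_subgraph_def)
  ultimately show ?thesis
    using rtrancl_mono by blast
qed

lemma color_components_eq_blocks:
  assumes "finite_ugraph G" and colored: "(P, c) \<in> colored_partitions k G"
    and agrees: "\<And>A v. A \<in> P \<Longrightarrow> v \<in> A \<Longrightarrow> f v = c A"
  shows "color_components G f = P"
proof -
  have partition: "partition_on (verts G) P"
    using colored by (simp add: colored_partitions_def)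
  have "color_connected G f = {(a, b). \<exists>A\<in>P. a \<in> A \<and> b \<in> A}"
  proof (intro equalityI subrelI)
    fix a b assume "(a, b) \<in> color_connected G f"
    then have path: "(a, b) \<in> (same_color_edges G f)\<^sup>*" and "a \<in> verts G"
      by (simp_all add: color_connected_def)
    then obtain A where "A \<in> P" "a \<in> A"
      using partition by (auto simp: partition_on_def)
    then show "(a, b) \<in> {(a, b). \<exists>A\<in>P. a \<in> A \<and> b \<in> A}"
      using same_color_path_stays_in_block[OF assms _ _ path] by auto
  next
    fix a b assume "(a, b) \<in> {(a, b). \<exists>A\<in>P. a \<in> A \<and> b \<in> A}"
    then show "(a, b) \<in> color_connected G f"
      using block_same_color_path[OF colored agrees] partition
      by (auto simp: color_connected_def partition_on_def)
  qed
  then show ?thesis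
    unfolding color_components_def using partition_on_eq_quotient[OF partition] by simp
qed

lemma ex_coloring_of_colored_partition:
  assumes "(P, c) \<in> colored_partitions k G"
  shows "\<exists>f \<in> verts G \<rightarrow>\<^sub>E {1..k}. \<forall>A\<in>P. \<forall>v\<in>A. f v = c A"
proof -
  have partition: "\<Union>P = verts G" "disjoint P" and colors: "c \<in> P \<rightarrow>\<^sub>E {1..k}"
    using assms by (auto simp: colored_partitions_def partition_on_def)
  have "\<forall>v\<in>verts G. \<exists>A\<in>P. v \<in> A"
    using partition(1) by auto
  then obtain block where block: "\<And>v. v \<in> verts G \<Longrightarrow> block v \<in> P \<and> v \<in> block v"
    by metis
  have "(\<lambda>v\<in>verts G. c (block v)) v = c A" if "A \<in> P" "v \<in> A" for A v
  proof -
    have vert: "v \<in> verts G"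
      using that partition(1) by auto
    then have "block v = A"
      using block[OF vert] that disjointD[OF partition(2), of "block v" A] by blast
    then show ?thesis using vert by simp
  qed
  moreover have "(\<lambda>v\<in>verts G. c (block v)) \<in> verts G \<rightarrow>\<^sub>E {1..k}"
    using block PiE_mem[OF colors] by simp
  ultimately show ?thesis by blast
qed

lemma inj_on_coloring_partition: "inj_on (coloring_partition G) (verts G \<rightarrow>\<^sub>E C)"
proof (rule inj_onI)
  fix f g assume colorings: "f \<in> verts G \<rightarrow>\<^sub>E C" "g \<in> verts G \<rightarrow>\<^sub>E C"
    and same: "coloring_partition G f = coloring_partition G g"
  show "f = g"
  proof (rule PiE_ext[OF colorings])
    fix v assume "v \<in> verts G"
    then obtain A where component: "A \<in> color_components G f" "v \<in> A"
      using ex_color_component[of v G f] by blast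
    have blocks: "color_components G f = color_components G g"
      using same by (simp add: coloring_partition_def)
    have "f v = snd (coloring_partition G f) A"
      using component by (simp add: coloring_partition_def the_elem_image_color_component)
    also have "\<dots> = g v"
      using component unfolding same
      by (simp add: blocks coloring_partition_def the_elem_image_color_component)
    finally show "f v = g v" .
  qed
qed

lemma colored_partition_in_image_coloring_partition:
  assumes "finite_ugraph G" and "T \<in> colored_partitions k G"
  shows "T \<in> coloring_partition G ` (verts G \<rightarrow>\<^sub>E {1..k})"
proof -
  obtain P c where T_eq: "T = (P, c)" and colored: "(P, c) \<in> colored_partitions k G"
    using assms(2) by (cases T) simp
  then have partition: "partition_on (verts G) P" and colors: "c \<in> P \<rightarrow>\<^sub>E {1..k}"
    by (auto simp: colored_partitions_def)
  obtain f where coloring: "f \<in> verts G \<rightarrow>\<^sub>E {1..k}"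
    and agrees: "\<And>A v. A \<in> P \<Longrightarrow> v \<in> A \<Longrightarrow> f v = c A"
    using ex_coloring_of_colored_partition[OF colored] by blast
  have "the_elem (f ` A) = c A" if "A \<in> P" for A
  proof (rule the_elem_image_unique)
    show "A \<noteq> {}" using that partition_onD3[OF partition] by metis
  qed (rule agrees[OF that])
  then have "(\<lambda>A\<in>P. the_elem (f ` A)) = c"
    using colors by (intro extensionalityI[of _ P]) (auto simp: PiE_iff)
  moreover have "color_components G f = P"
    by (rule color_components_eq_blocks[OF assms(1) colored agrees])
  ultimately have "coloring_partition G f = T"
    by (simp add: coloring_partition_def T_eq)
  then show ?thesis using coloring by blast
qed

lemma bij_betw_coloring_partition:
  assumes "finite_ugraph G"
  shows "bij_betw (coloring_partition G) (verts G \<rightarrow>\<^sub>E {1..k}) (colored_partitions k G)"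
  using inj_on_coloring_partition coloring_partition_in_colored_partitions[OF assms]
    colored_partition_in_image_coloring_partition[OF assms]
  by (intro bij_betw_imageI) blast+

subsection \<open>Counting color components column by column\<close>

abbreviation clique_path :: "nat \<Rightarrow> nat \<Rightarrow> (nat \<times> nat) ugraph" where
  "clique_path m n \<equiv> cartesian_product (complete_graph m) (path_graph n)"

definition column :: "('v \<times> nat \<Rightarrow> 'c) \<Rightarrow> nat \<Rightarrow> 'v \<Rightarrow> 'c" where
  "column f i v = f (v, i)"

definition persistent_colors :: "'v set \<Rightarrow> ('v \<Rightarrow> 'c) \<Rightarrow> ('v \<Rightarrow> 'c) \<Rightarrow> 'c set" where
  "persistent_colors V g h = {h v | v. v \<in> V \<and> g v = h v}"

definition new_colors :: "'v set \<Rightarrow> ('v \<Rightarrow> 'c) \<Rightarrow> ('v \<Rightarrow> 'c) \<Rightarrow> 'c set" where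
  "new_colors V g h = h ` V - persistent_colors V g h"

primrec starting_colors :: "'v set \<Rightarrow> ('v \<times> nat \<Rightarrow> 'c) \<Rightarrow> nat \<Rightarrow> 'c set" where
  "starting_colors V f 0 = column f 0 ` V"
| "starting_colors V f (Suc i) = new_colors V (column f i) (column f (Suc i))"

primrec first_column :: "'v set \<Rightarrow> ('v \<times> nat \<Rightarrow> 'c) \<Rightarrow> 'c \<Rightarrow> nat \<Rightarrow> nat" where
  "first_column V f c 0 = 0"
| "first_column V f c (Suc j) =
     (if c \<in> persistent_colors V (column f j) (column f (Suc j))
      then first_column V f c j else Suc j)"

definition component_label :: "'v set \<Rightarrow> ('v \<times> nat \<Rightarrow> 'c) \<Rightarrow> 'v \<times> nat \<Rightarrow> nat \<times> 'c" where
  "component_label V f p = (first_column V f (f p) (snd p), f p)"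

lemma persistent_colors_subset: "persistent_colors V g h \<subseteq> g ` V"
  by (auto simp: persistent_colors_def intro: rev_image_eqI)

lemma starting_colors_subset: "starting_colors V f i \<subseteq> column f i ` V"
  by (cases i) (auto simp: new_colors_def)

lemma first_column_le: "first_column V f c j \<le> j"
  by (induction j) auto

lemma first_column_starting_color:
  "c \<in> column f j ` V \<Longrightarrow> c \<in> starting_colors V f (first_column V f c j)"
proof (induction j)
  case (Suc j)
  then show ?case
    using persistent_colors_subset[of V "column f j" "column f (Suc j)"]
    by (auto simp: new_colors_def)
qed simp

lemma first_column_persistent:
  assumes "v \<in> V" "f (v, j) = c" "f (v, Suc j) = c"
  shows "first_column V f c (Suc j) = first_column V f c j"
  using assms by (auto simp: persistent_colors_def column_def)

lemma first_column_eq_self: "c \<in> starting_colors V f i \<Longrightarrow> first_column V f c i = i"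
  by (cases i) (auto simp: new_colors_def)

lemma component_label_image:
  "component_label V f ` (V \<times> {..<n}) = (SIGMA i:{..<n}. starting_colors V f i)"
proof (intro equalityI subsetI)
  fix l assume "l \<in> component_label V f ` (V \<times> {..<n})"
  then obtain v j where "v \<in> V" "j < n" "l = component_label V f (v, j)"
    by auto
  then show "l \<in> (SIGMA i:{..<n}. starting_colors V f i)"
    using first_column_le[of V f "f (v, j)" j] first_column_starting_color[of "f (v, j)" f j V]
    by (auto simp: component_label_def column_def)
next
  fix l assume "l \<in> (SIGMA i:{..<n}. starting_colors V f i)"
  then obtain i c where label: "l = (i, c)" "i < n" "c \<in> starting_colors V f i"
    by auto
  then obtain v where vert: "v \<in> V" "f (v, i) = c"
    using starting_colors_subset[of V f i] by (auto simp: column_def)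
  have "component_label V f (v, i) = l"
    using label vert by (simp add: component_label_def first_column_eq_self)
  then show "l \<in> component_label V f ` (V \<times> {..<n})"
    using label(2) vert(1) by blast
qed

lemma edges_cartesian_product:
  "{(v, i), (w, j)} \<in> edges (cartesian_product G H) \<longleftrightarrow>
     v \<in> verts G \<and> w \<in> verts G \<and> i \<in> verts H \<and> j \<in> verts H \<and>
     (v = w \<and> {i, j} \<in> edges H \<or> i = j \<and> {v, w} \<in> edges G)"
  unfolding cartesian_product_def by (auto simp: doubleton_eq_iff insert_commute)

lemma verts_clique_path: "verts (clique_path m n) = {..<m} \<times> {..<n}"
  by (simp add: cartesian_product_def complete_graph_def path_graph_def)

lemma edges_clique_path:
  "{(v, i), (w, j)} \<in> edges (clique_path m n) \<longleftrightarrow> v < m \<and> w < m \<and> i < n \<and> j < n \<and>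
     (v = w \<and> (j = Suc i \<or> i = Suc j) \<or> i = j \<and> v \<noteq> w)"
  unfolding edges_cartesian_product
  by (auto simp: complete_graph_def path_graph_def doubleton_eq_iff)

lemma finite_ugraph_clique_path: "finite_ugraph (clique_path m n)"
  by (intro finite_ugraph_cartesian_product finite_ugraph_complete_graph finite_ugraph_path_graph)

lemma same_color_edge_component_label:
  assumes "(p, q) \<in> same_color_edges (clique_path m n) f"
  shows "component_label {..<m} f p = component_label {..<m} f q"
proof -
  obtain v i w j where pair: "p = (v, i)" "q = (w, j)"
    by (cases p, cases q)
  have edge: "{(v, i), (w, j)} \<in> edges (clique_path m n)" and color: "f (v, i) = f (w, j)"
    using assms by (auto simp: pair same_color_edges_def)
  consider "i = j" | "v = w" "j = Suc i" | "v = w" "i = Suc j"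
    using edge by (auto simp: edges_clique_path)
  then show ?thesis
    using color edge first_column_persistent[of v "{..<m}" f i "f (w, j)"]
      first_column_persistent[of v "{..<m}" f j "f (w, j)"]
    by cases (simp_all add: pair component_label_def edges_clique_path del: first_column.simps)
qed

lemma clique_path_edge_color_connected:
  assumes "{p, q} \<in> edges (clique_path m n)" "f p = f q"
  shows "(p, q) \<in> color_connected (clique_path m n) f"
  using assms same_color_edges_subset_color_connected[OF finite_ugraph_clique_path, of m n f]
  by (auto simp: same_color_edges_def)

lemma same_column_color_connected:
  assumes "v < m" "w < m" "i < n" "f (v, i) = f (w, i)"
  shows "((v, i), (w, i)) \<in> color_connected (clique_path m n) f"
proof (cases "v = w")
  case True
  then show ?thesis
    using assms by (simp add: color_connected_def verts_clique_path)
next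
  case False
  then show ?thesis
    using assms by (intro clique_path_edge_color_connected) (simp_all add: edges_clique_path)
qed

lemma first_column_color_connected:
  assumes "v < m" "j < n"
  shows "\<exists>w<m. ((v, j), (w, first_column {..<m} f (f (v, j)) j))
    \<in> color_connected (clique_path m n) f"
  using assms
proof (induction j arbitrary: v)
  case 0
  then show ?case
    using same_column_color_connected[of v m v 0 n f] by auto
next
  case (Suc j)
  show ?case
  proof (cases "f (v, Suc j) \<in> persistent_colors {..<m} (column f j) (column f (Suc j))")
    case True
    then obtain u where persists: "u < m" "f (u, Suc j) = f (v, Suc j)" "f (u, j) = f (v, Suc j)"
      by (auto simp: persistent_colors_def column_def)
    have "((v, Suc j), (u, Suc j)) \<in> color_connected (clique_path m n) f"
      using persists Suc.prems by (intro same_column_color_connected) simp_all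
    moreover have "((u, Suc j), (u, j)) \<in> color_connected (clique_path m n) f"
      using persists Suc.prems
      by (intro clique_path_edge_color_connected) (simp_all add: edges_clique_path)
    moreover obtain w where "w < m"
      "((u, j), (w, first_column {..<m} f (f (u, j)) j)) \<in> color_connected (clique_path m n) f"
      using Suc.IH[OF persists(1)] Suc.prems(2) by auto
    ultimately show ?thesis
      using True persists(3) equivE[OF equiv_color_connected]
      by (metis first_column.simps(2) transE)
  next
    case False
    then show ?thesis
      using Suc.prems same_column_color_connected[of v m v "Suc j" n f] by auto
  qed
qed

lemma color_connected_clique_path_iff:
  assumes verts: "p \<in> verts (clique_path m n)" "q \<in> verts (clique_path m n)"
  shows "(p, q) \<in> color_connected (clique_path m n) f \<longleftrightarrow>
    component_label {..<m} f p = component_label {..<m} f q"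
proof
  assume "(p, q) \<in> color_connected (clique_path m n) f"
  then have "(p, q) \<in> (same_color_edges (clique_path m n) f)\<^sup>*"
    by (simp add: color_connected_def)
  then show "component_label {..<m} f p = component_label {..<m} f q"
    by (induction rule: rtrancl_induct) (auto dest: same_color_edge_component_label)
next
  let ?R = "color_connected (clique_path m n) f"
  assume "component_label {..<m} f p = component_label {..<m} f q"
  then have color: "f p = f q" and
    first: "first_column {..<m} f (f p) (snd p) = first_column {..<m} f (f q) (snd q)"
    by (auto simp: component_label_def)
  define r where "r = first_column {..<m} f (f q) (snd q)"
  obtain u where u_connected: "u < m" "(p, (u, r)) \<in> ?R"
    using verts(1) first first_column_color_connected[of "fst p" m "snd p" n f]
    by (auto simp: verts_clique_path r_def)
  obtain w where w_connected: "w < m" "(q, (w, r)) \<in> ?R"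
    using verts(2) first_column_color_connected[of "fst q" m "snd q" n f]
    by (auto simp: verts_clique_path r_def)
  have "r < n"
    using u_connected(2) by (simp add: color_connected_def verts_clique_path)
  moreover have "f (u, r) = f (w, r)"
    using color color_connected_imp_same_color[OF u_connected(2)]
      color_connected_imp_same_color[OF w_connected(2)] by simp
  ultimately have "((u, r), (w, r)) \<in> ?R"
    using u_connected(1) w_connected(1) by (intro same_column_color_connected)
  then show "(p, q) \<in> ?R"
    using u_connected(2) w_connected(2) equivE[OF equiv_color_connected] by (metis symE transE)
qed

lemma card_quotient_eq_card_image:
  assumes "equiv A r" and "\<And>x y. x \<in> A \<Longrightarrow> y \<in> A \<Longrightarrow> (x, y) \<in> r \<longleftrightarrow> h x = h y"
  shows "card (A // r) = card (h ` A)"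
proof -
  have "r `` {x} = {y \<in> A. h y = h x}" if "x \<in> A" for x
    using assms(2)[OF that] equiv_type[OF assms(1)] by auto
  then have "A // r = (\<lambda>b. {y \<in> A. h y = b}) ` h ` A"
    by (auto simp: quotient_def)
  moreover have "inj_on (\<lambda>b. {y \<in> A. h y = b}) (h ` A)"
    by (auto simp: inj_on_def)
  ultimately show ?thesis by (simp add: card_image)
qed

lemma card_color_components_clique_path:
  "card (color_components (clique_path m n) f) = (\<Sum>i<n. card (starting_colors {..<m} f i))"
proof -
  have "card (color_components (clique_path m n) f) =
      card (component_label {..<m} f ` ({..<m} \<times> {..<n}))"
    unfolding color_components_def verts_clique_path[symmetric]
    by (intro card_quotient_eq_card_image equiv_color_connected color_connected_clique_path_iff)
  also have "\<dots> = (\<Sum>i<n. card (starting_colors {..<m} f i))"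
    unfolding component_label_image
    by (intro card_SigmaI) (auto intro: finite_subset[OF starting_colors_subset])
  finally show ?thesis .
qed

definition coloring_weight :: "'a::comm_semiring_1 \<Rightarrow> 'v set \<Rightarrow> nat \<Rightarrow> ('v \<times> nat \<Rightarrow> 'c) \<Rightarrow> 'a" where
  "coloring_weight y V n f = y ^ (\<Sum>i<n. card (starting_colors V f i))"

lemma sum_monom_partition_size_clique_path:
  "(\<Sum>T\<in>colored_partitions k (clique_path m n). monom (1::'a::comm_semiring_1) (partition_size T)) =
     (\<Sum>f\<in>{..<m} \<times> {..<n} \<rightarrow>\<^sub>E {1..k}. coloring_weight (monom 1 1) {..<m} n f)"
proof -
  have "monom (1::'a) (partition_size (coloring_partition (clique_path m n) f)) =
      coloring_weight (monom 1 1) {..<m} n f" for f :: "nat \<times> nat \<Rightarrow> nat"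
    by (simp add: partition_size_def coloring_partition_def coloring_weight_def
        card_color_components_clique_path monom_power)
  then show ?thesis
    using sum.reindex_bij_betw[OF bij_betw_coloring_partition[OF finite_ugraph_clique_path],
        of "\<lambda>T. monom (1::'a) (partition_size T)" m n k]
    by (simp add: verts_clique_path)
qed

subsection \<open>The transfer recurrence for the last column\<close>

definition append_column ::
  "nat \<Rightarrow> ('v \<times> nat \<Rightarrow> 'c) \<Rightarrow> ('v \<Rightarrow> 'c) \<Rightarrow> 'v \<times> nat \<Rightarrow> 'c" where
  "append_column n f h = (\<lambda>(v, i). if i = n then h v else f (v, i))"

definition last_column_weight ::
  "'a::comm_semiring_1 \<Rightarrow> 'v set \<Rightarrow> 'c set \<Rightarrow> nat \<Rightarrow> ('v \<Rightarrow> 'c) \<Rightarrow> 'a" where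
  "last_column_weight y V C n h =
     (\<Sum>f\<in>V \<times> {..<n} \<rightarrow>\<^sub>E C. coloring_weight y V (Suc n) (append_column n f h))"

lemma column_append_column:
  "column (append_column n f h) i = (if i = n then h else column f i)"
  by (auto simp: append_column_def column_def)

lemma starting_colors_append_column:
  "i < n \<Longrightarrow> starting_colors V (append_column n f h) i = starting_colors V f i"
  by (cases i) (auto simp: column_append_column)

lemma append_column_in_PiE:
  assumes "f \<in> V \<times> {..<n} \<rightarrow>\<^sub>E C" "h \<in> V \<rightarrow>\<^sub>E C"
  shows "append_column n f h \<in> V \<times> {..<Suc n} \<rightarrow>\<^sub>E C"
proof (rule PiE_I)
  fix p assume "p \<notin> V \<times> {..<Suc n}"
  then show "append_column n f h p = undefined"
    using PiE_arb[OF assms(1), of p] PiE_arb[OF assms(2), of "fst p"]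
    by (cases p) (auto simp: append_column_def)
qed (use assms in \<open>auto simp: append_column_def less_Suc_eq\<close>)

lemma bij_betw_append_column:
  "bij_betw (\<lambda>(f, h). append_column n f h)
     ((V \<times> {..<n} \<rightarrow>\<^sub>E C) \<times> (V \<rightarrow>\<^sub>E C)) (V \<times> {..<Suc n} \<rightarrow>\<^sub>E C)"
proof (rule bij_betw_byWitness[where f' = "\<lambda>f. (restrict f (V \<times> {..<n}), column f n)"])
  have "restrict (append_column n f h) (V \<times> {..<n}) = f" if "f \<in> V \<times> {..<n} \<rightarrow>\<^sub>E C" for f h
    using that
    by (intro extensionalityI[of _ "V \<times> {..<n}"]) (auto simp: PiE_iff append_column_def)
  then show "\<forall>p\<in>(V \<times> {..<n} \<rightarrow>\<^sub>E C) \<times> (V \<rightarrow>\<^sub>E C).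
      (\<lambda>f. (restrict f (V \<times> {..<n}), column f n)) ((\<lambda>(f, h). append_column n f h) p) = p"
    by (auto simp: column_append_column)
  have "append_column n (restrict f (V \<times> {..<n})) (column f n) = f"
    if "f \<in> V \<times> {..<Suc n} \<rightarrow>\<^sub>E C" for f
    using that by (intro extensionalityI[of _ "V \<times> {..<Suc n}"])
      (auto simp: PiE_iff extensional_def append_column_def column_def less_Suc_eq)
  then show "\<forall>f\<in>V \<times> {..<Suc n} \<rightarrow>\<^sub>E C.
      (\<lambda>(f, h). append_column n f h) (restrict f (V \<times> {..<n}), column f n) = f"
    by simp
  show "(\<lambda>(f, h). append_column n f h) ` ((V \<times> {..<n} \<rightarrow>\<^sub>E C) \<times> (V \<rightarrow>\<^sub>E C))
      \<subseteq> V \<times> {..<Suc n} \<rightarrow>\<^sub>E C"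
    by (rule image_subsetI) (simp add: append_column_in_PiE case_prod_unfold mem_Times_iff)
  show "(\<lambda>f. (restrict f (V \<times> {..<n}), column f n)) ` (V \<times> {..<Suc n} \<rightarrow>\<^sub>E C)
      \<subseteq> (V \<times> {..<n} \<rightarrow>\<^sub>E C) \<times> (V \<rightarrow>\<^sub>E C)"
    by (auto simp: PiE_iff extensional_def column_def)
qed

lemma sum_by_last_column:
  "(\<Sum>f\<in>V \<times> {..<Suc n} \<rightarrow>\<^sub>E C. F f) =
     (\<Sum>h\<in>V \<rightarrow>\<^sub>E C. \<Sum>f\<in>V \<times> {..<n} \<rightarrow>\<^sub>E C. F (append_column n f h))"
proof -
  have "(\<Sum>f\<in>V \<times> {..<Suc n} \<rightarrow>\<^sub>E C. F f) =
      (\<Sum>(f, h)\<in>(V \<times> {..<n} \<rightarrow>\<^sub>E C) \<times> (V \<rightarrow>\<^sub>E C). F (append_column n f h))"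
    by (subst sum.reindex_bij_betw[OF bij_betw_append_column, symmetric])
      (simp add: case_prod_unfold)
  then show ?thesis
    by (simp add: sum.cartesian_product[symmetric] sum.swap[of _ _ "V \<rightarrow>\<^sub>E C"])
qed

lemma sum_coloring_weight_Suc:
  "(\<Sum>f\<in>V \<times> {..<Suc n} \<rightarrow>\<^sub>E C. coloring_weight y V (Suc n) f) =
     (\<Sum>h\<in>V \<rightarrow>\<^sub>E C. last_column_weight y V C n h)"
  unfolding last_column_weight_def by (rule sum_by_last_column)

lemma last_column_weight_0: "last_column_weight y V C 0 h = y ^ card (h ` V)"
  by (simp add: last_column_weight_def coloring_weight_def column_append_column)

lemma coloring_weight_append_column:
  "coloring_weight y V (Suc (Suc n)) (append_column (Suc n) f h) =
     coloring_weight y V (Suc n) f * y ^ card (new_colors V (column f n) h)"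
proof -
  have "(\<Sum>i<Suc n. card (starting_colors V (append_column (Suc n) f h) i)) =
      (\<Sum>i<Suc n. card (starting_colors V f i))"
    by (intro sum.cong) (simp_all add: starting_colors_append_column)
  then show ?thesis
    by (simp add: coloring_weight_def column_append_column power_add sum.lessThan_Suc[of _ "Suc n"]
        del: sum.lessThan_Suc)
qed

lemma last_column_weight_Suc:
  "last_column_weight y V C (Suc n) h =
     (\<Sum>g\<in>V \<rightarrow>\<^sub>E C. last_column_weight y V C n g * y ^ card (new_colors V g h))"
proof -
  have "last_column_weight y V C (Suc n) h =
      (\<Sum>g\<in>V \<rightarrow>\<^sub>E C. \<Sum>f\<in>V \<times> {..<n} \<rightarrow>\<^sub>E C.
        coloring_weight y V (Suc n) (append_column n f g) *
        y ^ card (new_colors V (column (append_column n f g) n) h))"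
    unfolding last_column_weight_def coloring_weight_append_column by (rule sum_by_last_column)
  then show ?thesis
    by (simp add: last_column_weight_def column_append_column sum_distrib_right)
qed

subsection \<open>Two colors: columns as subsets\<close>

definition two_coloring :: "'v set \<Rightarrow> 'v set \<Rightarrow> 'v \<Rightarrow> nat" where
  "two_coloring V S = (\<lambda>v\<in>V. if v \<in> S then 1 else 2)"

lemma bij_betw_two_coloring: "bij_betw (two_coloring V) (Pow V) (V \<rightarrow>\<^sub>E {1..2})"
proof (rule bij_betw_byWitness[where f' = "\<lambda>f. {v \<in> V. f v = 1}"])
  have "two_coloring V {v \<in> V. f v = 1} = f" if coloring: "f \<in> V \<rightarrow>\<^sub>E {1..2}" for f
  proof (rule PiE_ext[OF _ coloring])
    show "two_coloring V {v \<in> V. f v = 1} \<in> V \<rightarrow>\<^sub>E {1..2}"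
      by (auto simp: two_coloring_def)
    show "two_coloring V {v \<in> V. f v = 1} v = f v" if "v \<in> V" for v
      using PiE_mem[OF coloring that] that by (auto simp: two_coloring_def)
  qed
  then show "\<forall>f\<in>V \<rightarrow>\<^sub>E {1..2}. two_coloring V {v \<in> V. f v = 1} = f"
    by blast
qed (auto simp: two_coloring_def)

lemma card_subset_doubleton:
  assumes "D \<subseteq> {a, b}" "a \<noteq> b"
  shows "card D = of_bool (a \<in> D) + of_bool (b \<in> D)"
proof -
  have "D \<in> Pow {a, b}"
    using assms(1) by simp
  then show ?thesis
    using assms(2) by (auto simp: Pow_insert)
qed

lemma card_two_coloring_image:
  assumes "S \<subseteq> V"
  shows "card (two_coloring V S ` V) = of_bool (S \<noteq> {}) + of_bool (S \<noteq> V)"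
proof -
  have "1 \<in> two_coloring V S ` V \<longleftrightarrow> S \<noteq> {}" "2 \<in> two_coloring V S ` V \<longleftrightarrow> S \<noteq> V"
    using assms by (auto simp: two_coloring_def image_iff)
  moreover have "two_coloring V S ` V \<subseteq> {1, 2}"
    by (auto simp: two_coloring_def)
  ultimately show ?thesis
    by (simp add: card_subset_doubleton[of _ 1 2])
qed

lemma card_new_colors_two_coloring:
  assumes "R \<subseteq> V" "S \<subseteq> V"
  shows "card (new_colors V (two_coloring V R) (two_coloring V S)) =
    of_bool (S \<noteq> {} \<and> S \<inter> R = {}) + of_bool (S \<noteq> V \<and> S \<union> R = V)"
proof -
  let ?N = "new_colors V (two_coloring V R) (two_coloring V S)"
  have "1 \<in> ?N \<longleftrightarrow> S \<noteq> {} \<and> S \<inter> R = {}" "2 \<in> ?N \<longleftrightarrow> S \<noteq> V \<and> S \<union> R = V"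
    using assms by (auto simp: new_colors_def persistent_colors_def two_coloring_def image_iff)
  moreover have "?N \<subseteq> {1, 2}"
    by (auto simp: new_colors_def two_coloring_def)
  ultimately show ?thesis
    by (simp add: card_subset_doubleton[of _ 1 2])
qed

lemma card_subsets_disjoint_from:
  assumes "finite V" "R \<subseteq> V"
  shows "card {S. S \<subseteq> V \<and> card S = s \<and> S \<inter> R = {}} = (card V - card R) choose s"
proof -
  have "{S. S \<subseteq> V \<and> card S = s \<and> S \<inter> R = {}} = {S. S \<subseteq> V - R \<and> card S = s}"
    by auto
  then show ?thesis
    using assms by (simp add: n_subsets card_Diff_subset finite_subset)
qed

lemma card_subsets_covering_with:
  assumes "finite V" "R \<subseteq> V" "s \<le> card V"
  shows "card {S. S \<subseteq> V \<and> card S = s \<and> S \<union> R = V} = card R choose (card V - s)"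
proof -
  have "bij_betw (\<lambda>S. V - S) {S. S \<subseteq> V \<and> card S = s \<and> S \<union> R = V}
      {U. U \<subseteq> R \<and> card U = card V - s}"
    using assms by (intro bij_betw_byWitness[where f' = "\<lambda>U. V - U"])
      (auto simp: card_Diff_subset finite_subset double_diff)
  then show ?thesis
    using assms(1,2) by (simp add: bij_betw_same_card n_subsets finite_subset)
qed

lemma card_subsets_complementary_to:
  assumes "finite V" "R \<subseteq> V"
  shows "card {S. S \<subseteq> V \<and> card S = s \<and> S \<inter> R = {} \<and> S \<union> R = V} = of_bool (card R + s = card V)"
proof -
  have "{S. S \<subseteq> V \<and> card S = s \<and> S \<inter> R = {} \<and> S \<union> R = V} = {S. S = V - R \<and> card S = s}"
    using assms(2) by auto
  moreover have "card (V - R) = s \<longleftrightarrow> card R + s = card V"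
    using assms card_mono[of V R] by (auto simp: card_Diff_subset finite_subset)
  ultimately show ?thesis
    by (cases "card (V - R) = s") (auto cong: conj_cong)
qed

lemma subset_neq_iff_card:
  assumes "finite V" "S \<subseteq> V"
  shows "S \<noteq> V \<longleftrightarrow> card S < card V" and "S \<noteq> {} \<longleftrightarrow> 0 < card S"
  using assms card_subset_eq[of V S] psubset_card_mono[of V S]
  by (auto simp: card_gt_0_iff finite_subset)

text \<open>
  Here \<open>r\<close> and \<open>s\<close> count the vertices of color 1 in two consecutive columns.
  The three summands come from
  \<open>y ^ (a + b) = 1 + (y - 1) (a + b) + (y - 1)^2 a b\<close> for \<open>a\<close>, \<open>b\<close> in
  \<open>{0, 1}\<close>, where \<open>a\<close> and \<open>b\<close> say whether colors 1 and 2 start a new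
  component.
\<close>

definition size_transition :: "'a::comm_ring_1 \<Rightarrow> nat \<Rightarrow> nat \<Rightarrow> nat \<Rightarrow> 'a" where
  "size_transition y m r s = of_nat (m choose s)
     + (y - 1) * of_nat (of_bool (0 < s) * (m - r choose s) + of_bool (s < m) * (r choose (m - s)))
     + (y - 1)^2 * of_bool (0 < s \<and> s < m \<and> r + s = m)"

lemma power_card_new_colors_two_coloring:
  fixes y :: "'a::comm_ring_1"
  assumes "finite V" "R \<subseteq> V" "S \<subseteq> V"
  shows "y ^ card (new_colors V (two_coloring V R) (two_coloring V S)) =
    1 + (y - 1) * (of_bool (0 < card S \<and> S \<inter> R = {}) + of_bool (card S < card V \<and> S \<union> R = V))
      + (y - 1)^2 * of_bool (0 < card S \<and> card S < card V \<and> S \<inter> R = {} \<and> S \<union> R = V)"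
  unfolding card_new_colors_two_coloring[OF assms(2,3)] subset_neq_iff_card[OF assms(1,3)]
  by (auto simp: power2_eq_square algebra_simps)

lemma sum_power_card_new_colors:
  fixes y :: "'a::comm_ring_1"
  assumes "finite V" "R \<subseteq> V"
  shows "(\<Sum>S | S \<subseteq> V \<and> card S = s.
      y ^ card (new_colors V (two_coloring V R) (two_coloring V S))) =
    size_transition y (card V) (card R) s"
proof -
  let ?m = "card V" and ?class = "{S. S \<subseteq> V \<and> card S = s}"
  let ?disj = "{S. 0 < s \<and> S \<inter> R = {}}" and ?cover = "{S. s < ?m \<and> S \<union> R = V}"
    and ?compl = "{S. 0 < s \<and> s < ?m \<and> S \<inter> R = {} \<and> S \<union> R = V}"
  have "(\<Sum>S\<in>?class. y ^ card (new_colors V (two_coloring V R) (two_coloring V S))) =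
      (\<Sum>S\<in>?class. 1 + (y - 1) * (of_bool (S \<in> ?disj) + of_bool (S \<in> ?cover))
        + (y - 1)^2 * of_bool (S \<in> ?compl))"
    using assms by (intro sum.cong) (auto simp: power_card_new_colors_two_coloring)
  also have "\<dots> = of_nat (card ?class)
      + (y - 1) * of_nat (card (?class \<inter> ?disj) + card (?class \<inter> ?cover))
      + (y - 1)^2 * of_nat (card (?class \<inter> ?compl))"
    using assms(1) by (simp add: sum.distrib sum_distrib_left[symmetric])
  also have "card ?class = ?m choose s"
    by (rule n_subsets[OF assms(1)])
  also have "card (?class \<inter> ?disj) = of_bool (0 < s) * (?m - card R choose s)"
    using card_subsets_disjoint_from[OF assms, of s] by (simp add: Int_def conj_ac)
  also have "card (?class \<inter> ?cover) = of_bool (s < ?m) * (card R choose (?m - s))"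
    using card_subsets_covering_with[OF assms, of s] by (simp add: Int_def conj_ac)
  also have "?class \<inter> ?compl = (if 0 < s \<and> s < ?m
      then {S. S \<subseteq> V \<and> card S = s \<and> S \<inter> R = {} \<and> S \<union> R = V} else {})"
    by auto
  finally show ?thesis
    by (simp add: size_transition_def card_subsets_complementary_to[OF assms])
qed

lemma size_transition_complement:
  assumes "r \<le> m" "s \<le> m"
  shows "size_transition y m (m - r) (m - s) = size_transition y m r s"
proof -
  have "m choose (m - s) = m choose s"
    using assms by (simp add: binomial_symmetric[symmetric])
  moreover have "m - r + (m - s) = m \<longleftrightarrow> r + s = m" "0 < m - s \<longleftrightarrow> s < m" "m - s < m \<longleftrightarrow> 0 < s"
    using assms by auto
  ultimately show ?thesis
    using assms by (simp add: size_transition_def add.commute conj_ac)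
qed

subsection \<open>Size classes of columns\<close>

definition size_class_weight :: "'a::comm_semiring_1 \<Rightarrow> 'v set \<Rightarrow> nat \<Rightarrow> nat \<Rightarrow> 'a" where
  "size_class_weight y V n s =
     (\<Sum>S | S \<subseteq> V \<and> card S = s. last_column_weight y V {1..2} n (two_coloring V S))"

lemma sum_over_size_classes:
  assumes "finite V"
  shows "(\<Sum>S\<in>Pow V. F S) = (\<Sum>s\<le>card V. \<Sum>S | S \<subseteq> V \<and> card S = s. F S)"
proof -
  have "card ` Pow V \<subseteq> {..card V}"
    using assms by (auto intro: card_mono)
  then show ?thesis
    using sum.group[of "Pow V" "{..card V}" card F] assms by simp
qed

lemma sum_last_column_weight:
  assumes "finite V"
  shows "(\<Sum>h\<in>V \<rightarrow>\<^sub>E {1..2}. last_column_weight y V {1..2::nat} n h) =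
    (\<Sum>s\<le>card V. size_class_weight y V n s)"
  unfolding size_class_weight_def sum_over_size_classes[OF assms, symmetric]
  by (rule sum.reindex_bij_betw[OF bij_betw_two_coloring, symmetric])

lemma size_class_weight_0:
  assumes "finite V"
  shows "size_class_weight y V 0 s =
    of_nat (card V choose s) * y ^ (of_bool (0 < s) + of_bool (s < card V))"
proof -
  have "last_column_weight y V {1..2} 0 (two_coloring V S) =
      y ^ (of_bool (0 < s) + of_bool (s < card V))" if "S \<subseteq> V" "card S = s" for S
    using that(2)
    by (simp add: last_column_weight_0 card_two_coloring_image[OF that(1)]
        subset_neq_iff_card[OF assms that(1)])
  then show ?thesis
    using assms by (simp add: size_class_weight_def n_subsets)
qed

lemma size_class_weight_Suc:
  fixes y :: "'a::comm_ring_1"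
  assumes "finite V"
  shows "size_class_weight y V (Suc n) s =
    (\<Sum>r\<le>card V. size_transition y (card V) r s * size_class_weight y V n r)"
proof -
  let ?W = "\<lambda>R. last_column_weight y V {1..2} n (two_coloring V R)"
  have "size_class_weight y V (Suc n) s = (\<Sum>S | S \<subseteq> V \<and> card S = s. \<Sum>R\<in>Pow V.
      ?W R * y ^ card (new_colors V (two_coloring V R) (two_coloring V S)))"
    unfolding size_class_weight_def last_column_weight_Suc
    by (intro sum.cong refl sum.reindex_bij_betw[OF bij_betw_two_coloring, symmetric])
  also have "\<dots> = (\<Sum>R\<in>Pow V. ?W R * size_transition y (card V) (card R) s)"
    by (subst sum.swap)
      (simp add: sum_distrib_left[symmetric] sum_power_card_new_colors[OF assms])
  also have "\<dots> = (\<Sum>r\<le>card V. size_transition y (card V) r s * size_class_weight y V n r)"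
    unfolding sum_over_size_classes[OF assms] size_class_weight_def sum_distrib_left
    by (intro sum.cong) (auto simp: mult.commute)
  finally show ?thesis .
qed

lemma size_class_weight_complement:
  fixes y :: "'a::comm_ring_1"
  assumes "finite V" "s \<le> card V"
  shows "size_class_weight y V n (card V - s) = size_class_weight y V n s"
  using assms(2)
proof (induction n arbitrary: s)
  case 0
  then have "card V choose (card V - s) = card V choose s"
    by (simp add: binomial_symmetric[symmetric])
  moreover have "0 < card V - s \<longleftrightarrow> s < card V" "card V - s < card V \<longleftrightarrow> 0 < s"
    using 0 by auto
  ultimately show ?case
    by (simp add: size_class_weight_0[OF assms(1)] add.commute)
next
  case (Suc n)
  let ?m = "card V"
  have "size_class_weight y V (Suc n) (?m - s) =
      (\<Sum>r\<le>?m. size_transition y ?m (?m - r) (?m - s) * size_class_weight y V n (?m - r))"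
    unfolding size_class_weight_Suc[OF assms(1)]
    by (rule sum.reindex_bij_witness[of _ "\<lambda>r. ?m - r" "\<lambda>r. ?m - r"]) auto
  also have "\<dots> = size_class_weight y V (Suc n) s"
    unfolding size_class_weight_Suc[OF assms(1)]
    by (intro sum.cong) (simp_all add: size_transition_complement Suc)
  finally show ?case .
qed

definition size_class_gf :: "'a::comm_semiring_1 \<Rightarrow> 'v set \<Rightarrow> nat \<Rightarrow> 'a fps" where
  "size_class_gf y V s = fps_X * Abs_fps (\<lambda>n. size_class_weight y V n s)"

lemma size_class_gf_complement:
  fixes y :: "'a::comm_ring_1"
  assumes "finite V" "s \<le> card V"
  shows "size_class_gf y V (card V - s) = size_class_gf y V s"
  by (simp add: size_class_gf_def size_class_weight_complement[OF assms])

lemma fps_const_size_transition: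
  "fps_const (size_transition y m r s) = size_transition (fps_const y) m r s"
proof -
  have "fps_const (of_bool P) = of_bool P" for P :: bool
    by simp
  then show ?thesis
    by (simp add: size_transition_def fps_const_add[symmetric] fps_const_mult[symmetric]
        fps_const_sub[symmetric] fps_const_power[symmetric] fps_of_nat
        del: fps_const_add fps_const_mult fps_const_sub fps_const_power)
qed

lemma size_class_gf_eq:
  fixes y :: "'a::comm_ring_1"
  assumes "finite V"
  shows "size_class_gf y V s = fps_X *
    (of_nat (card V choose s) * fps_const y ^ (of_bool (0 < s) + of_bool (s < card V)) +
     (\<Sum>r\<le>card V. size_transition (fps_const y) (card V) r s * size_class_gf y V r))"
proof -
  let ?W = "\<lambda>s. Abs_fps (\<lambda>n. size_class_weight y V n s)"
  have "?W s = fps_const (size_class_weight y V 0 s) +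
      (\<Sum>r\<le>card V. fps_const (size_transition y (card V) r s) * (fps_X * ?W r))"
  proof (rule fps_ext)
    fix n
    show "fps_nth (?W s) n = fps_nth (fps_const (size_class_weight y V 0 s) +
        (\<Sum>r\<le>card V. fps_const (size_transition y (card V) r s) * (fps_X * ?W r))) n"
      by (cases n) (simp_all add: fps_sum_nth size_class_weight_Suc[OF assms])
  qed
  moreover have "fps_const (size_class_weight y V 0 s) =
      of_nat (card V choose s) * fps_const y ^ (of_bool (0 < s) + of_bool (s < card V))"
    by (simp add: size_class_weight_0[OF assms] fps_of_nat[symmetric] fps_const_power[symmetric]
        fps_const_mult[symmetric] del: fps_const_power fps_const_mult)
  ultimately show ?thesis
    by (simp add: size_class_gf_def fps_const_size_transition)
qed

lemma colored_partition_gf_2_eq: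
  "colored_partition_gf 2 m = (\<Sum>s\<le>m. size_class_gf (monom 1 1) {..<m} s)"
proof (rule fps_ext)
  fix n
  show "fps_nth (colored_partition_gf 2 m) n =
      fps_nth (\<Sum>s\<le>m. size_class_gf (monom 1 1) {..<m} s) n"
    by (cases n) (simp_all add: colored_partition_gf_def sum_monom_partition_size_clique_path
        sum_coloring_weight_Suc sum_last_column_weight fps_sum_nth size_class_gf_def
        del: One_nat_def)
qed

subsection \<open>Columns of four vertices\<close>

lemma sum_size_class_gf_4:
  fixes y :: "'a::comm_ring_1"
  assumes "finite V" "card V = 4"
  shows "(\<Sum>s\<le>4. k s * size_class_gf y V s) = (k 0 + k 4) * size_class_gf y V 0 +
    (k 1 + k 3) * size_class_gf y V 1 + k 2 * size_class_gf y V 2"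
proof -
  have "size_class_gf y V 3 = size_class_gf y V 1" "size_class_gf y V 4 = size_class_gf y V 0"
    using size_class_gf_complement[of V 1 y] size_class_gf_complement[of V 0 y] assms by simp_all
  moreover have "{..4} = {0, 1, 2, 3, 4::nat}"
    by auto
  ultimately show ?thesis
    by (simp add: algebra_simps)
qed

lemma size_class_gf_4_system:
  fixes y :: "'a::comm_ring_1"
  assumes "finite V" "card V = 4"
  defines "a \<equiv> size_class_gf y V" and "Y \<equiv> fps_const y"
  shows "a 0 = fps_X * (Y + (1 + Y) * a 0 + 2 * a 1 + a 2)"
    and "a 1 = fps_X * (4 * Y^2 + 8 * Y * a 0 + (Y^2 + 3 * Y + 4) * a 1 + (2 * Y + 2) * a 2)"
    and "a 2 = fps_X * (6 * Y^2 + 12 * Y * a 0 + (6 * Y + 6) * a 1 + (Y^2 + 5) * a 2)"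
proof -
  have system: "a s = fps_X * (of_nat (4 choose s) * Y ^ (of_bool (0 < s) + of_bool (s < 4)) +
      (size_transition Y 4 0 s + size_transition Y 4 4 s) * a 0 +
      (size_transition Y 4 1 s + size_transition Y 4 3 s) * a 1 +
      size_transition Y 4 2 s * a 2)" for s
    using size_class_gf_eq[OF assms(1), of y s] assms(2)
    by (simp add: a_def Y_def sum_size_class_gf_4[OF assms(1,2)] add.assoc)
  have binomials: "(4::nat) choose 2 = 6" "(4::nat) choose 3 = 4" "(3::nat) choose 2 = 3"
    by (simp_all add: numeral_eq_Suc)
  show "a 0 = fps_X * (Y + (1 + Y) * a 0 + 2 * a 1 + a 2)"
    by (subst system) (simp add: size_transition_def binomial_eq_0 algebra_simps)
  show "a 1 = fps_X * (4 * Y^2 + 8 * Y * a 0 + (Y^2 + 3 * Y + 4) * a 1 + (2 * Y + 2) * a 2)"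
    by (subst system)
      (simp add: size_transition_def binomials binomial_eq_0 algebra_simps power2_eq_square)
  show "a 2 = fps_X * (6 * Y^2 + 12 * Y * a 0 + (6 * Y + 6) * a 1 + (Y^2 + 5) * a 2)"
    by (subst system)
      (simp add: size_transition_def binomials binomial_eq_0 algebra_simps power2_eq_square)
qed

lemma size_class_system_solution:
  fixes x y a\<^sub>0 a\<^sub>1 a\<^sub>2 :: "'a::comm_ring_1"
  assumes a\<^sub>0_eq: "a\<^sub>0 = x * (y + (1 + y) * a\<^sub>0 + 2 * a\<^sub>1 + a\<^sub>2)"
    and a\<^sub>1_eq: "a\<^sub>1 = x * (4 * y^2 + 8 * y * a\<^sub>0 + (y^2 + 3 * y + 4) * a\<^sub>1 + (2 * y + 2) * a\<^sub>2)"
    and a\<^sub>2_eq: "a\<^sub>2 = x * (6 * y^2 + 12 * y * a\<^sub>0 + (6 * y + 6) * a\<^sub>1 + (y^2 + 5) * a\<^sub>2)"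
  shows "(2 * a\<^sub>0 + 2 * a\<^sub>1 + a\<^sub>2) * (1 - 2 * x * (y^2 + 2 * y + 5)
           + x^2 * (y - 1) * (y^3 + 6 * y^2 + 8 * y - 17)
           - x^3 * (y - 1)^2 * (y^3 + 6 * y^2 - 17 * y + 8)) =
         2 * x * y * (1 + 7 * y - x * (y - 1) * (7 * y^2 + y - 9)
           + x^2 * (y - 1)^2 * (8 * y^2 - 17 * y + 8))" (is "?L = ?R")
proof -
  \<comment> \<open>By Cramer's rule, \<open>(2 u, 2 v, w)\<close> is the row vector \<open>(2, 2, 1)\<close> times the adjugate of
    the coefficient matrix, whose determinant is the second factor of \<open>?L\<close>.\<close>
  define u v w where weights:
    "u = (1 - x * (y - 1)^2) * (1 - x * (y - 1) * (y - 8))"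
    "v = (1 - x * (y - 1)) * (1 - x * (y - 1) * (y - 2))"
    "w = (1 - x * (y - 1)) * (1 - x * (y - 1) * y)"
  have "?L - ?R =
      2 * u * (a\<^sub>0 - x * (y + (1 + y) * a\<^sub>0 + 2 * a\<^sub>1 + a\<^sub>2)) +
      2 * v * (a\<^sub>1 - x * (4 * y^2 + 8 * y * a\<^sub>0 + (y^2 + 3 * y + 4) * a\<^sub>1 + (2 * y + 2) * a\<^sub>2)) +
      w * (a\<^sub>2 - x * (6 * y^2 + 12 * y * a\<^sub>0 + (6 * y + 6) * a\<^sub>1 + (y^2 + 5) * a\<^sub>2))"
    unfolding weights by (simp add: algebra_simps power2_eq_square power3_eq_cube)
  also have "\<dots> = 0"
    unfolding a\<^sub>0_eq[symmetric] a\<^sub>1_eq[symmetric] a\<^sub>2_eq[symmetric] by simp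
  finally show ?thesis by simp
qed

theorem theorem6p6:
  shows "colored_partition_gf 2 4 =
    (let x = gf_x; y = gf_y in
      fps_quotient
        (2 * x * y * (1 + 7 * y - x * (y - 1) * (7 * y^2 + y - 9)
           + x^2 * (y - 1)^2 * (8 * y^2 - 17 * y + 8)))
        (1 - 2 * x * (y^2 + 2 * y + 5)
           + x^2 * (y - 1) * (y^3 + 6 * y^2 + 8 * y - 17)
           - x^3 * (y - 1)^2 * (y^3 + 6 * y^2 - 17 * y + 8)))"
proof -
  let ?a = "size_class_gf (monom 1 1) {..<4::nat} :: nat \<Rightarrow> int poly fps"
  note system = size_class_gf_4_system[OF finite_lessThan card_lessThan,
      where y = "monom 1 1 :: int poly"]
  have "colored_partition_gf 2 4 = 2 * ?a 0 + 2 * ?a 1 + ?a 2"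
    using sum_size_class_gf_4[of "{..<4::nat}" "\<lambda>_. 1"] by (simp add: colored_partition_gf_2_eq)
  then show ?thesis
    unfolding Let_def
    by (subst fps_quotient_eq_iff) (simp, simp only: size_class_system_solution[OF system])
qed

end
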